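(* Let $M$ be a positive integer and let $f:K^+_{[0,1]}\to\mathbb{C}$ be a function. Then each of the following four functions interpolates $f$ on the indicated grid. (SMDCT-I) With $x_m=\frac{m}{M}$, $y_n=\frac{n}{M}$, the function $$\psi^{\mathrm{I},+}_M(x,y)=\sum_{\substack{k,l=0 \\ k\ge l}}^{M}c^{\mathrm{I},+}_{kl}\cos^+_{(k,l)}(x,y),\qquad c^{\mathrm{I},+}_{kl}=\frac{4d_{k,M}d_{l,M}}{M^2G_{kl}}\sum_{\substack{m,n=0 \\ m\ge n}}^{M}G_{mn}^{-1}d_{m,M}d_{n,M}f(x_m,y_n)\cos^+_{(k,l)}(x_m,y_n)$$ satisfies $\psi^{\mathrm{I},+}_M(x_m,y_n)=f(x_m,y_n)$ for all $m,n\in\{0,\dots,M\}$, $m\ge n$. (SMDCT-II) With $x_m=\frac{m+1/2}{M}$, $y_n=\frac{n+1/2}{M}$, the function $$\psi^{\mathrm{II},+}_M(x,y)=\sum_{\substack{k,l=0 \\ k\ge l}}^{M-1}c^{\mathrm{II},+}_{kl}\cos^+_{(k,l)}(x,y),\qquad c^{\mathrm{II},+}_{kl}=\frac{4d_{k,M}d_{l,M}}{M^2G_{kl}}\sum_{\substack{m,n=0 \\ m\ge n}}^{M-1}G_{mn}^{-1}f(x_m,y_n)\cos^+_{(k,l)}(x_m,y_n)$$ satisfies $\psi^{\mathrm{II},+}_M(x_m,y_n)=f(x_m,y_n)$ for all $m,n\in\{0,\dots,M-1\}$, $m\ge n$. (SMDCT-III) With $x_m=\frac{m}{M}$, $y_n=\frac{n}{M}$,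 the function $$\psi^{\mathrm{III},+}_M(x,y)=\sum_{\substack{k,l=0 \\ k\ge l}}^{M-1}c^{\mathrm{III},+}_{kl}\cos^+_{(k+\frac12,l+\frac12)}(x,y),\qquad c^{\mathrm{III},+}_{kl}=\frac{4}{M^2G_{kl}}\sum_{\substack{m,n=0 \\ m\ge n}}^{M-1}d_{m,M}d_{n,M}G_{mn}^{-1}f(x_m,y_n)\cos^+_{(k+\frac12,l+\frac12)}(x_m,y_n)$$ satisfies $\psi^{\mathrm{III},+}_M(x_m,y_n)=f(x_m,y_n)$ for all $m,n\in\{0,\dots,M-1\}$, $m\ge n$. (SMDCT-IV) With $x_m=\frac{m+1/2}{M}$, $y_n=\frac{n+1/2}{M}$, the function $$\psi^{\mathrm{IV},+}_M(x,y)=\sum_{\substack{k,l=0 \\ k\ge l}}^{M-1}c^{\mathrm{IV},+}_{kl}\cos^+_{(k+\frac12,l+\frac12)}(x,y),\qquad c^{\mathrm{IV},+}_{kl}=\frac{4}{M^2G_{kl}}\sum_{\substack{m,n=0 \\ m\ge n}}^{M-1}G_{mn}^{-1}f(x_m,y_n)\cos^+_{(k+\frac12,l+\frac12)}(x_m,y_n)$$ satisfies $\psi^{\mathrm{IV},+}_M(x_m,y_n)=f(x_m,y_n)$ for all $m,n\in\{0,\dots,M-1\}$, $m\ge n$.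
   Context: For $\lambda,\mu,x,y\in\mathbb{R}$, the symmetric cosine function is $\cos^+_{(\lambda,\mu)}(x,y)=\cos(\pi\lambda x)\cos(\pi\mu y)+\cos(\pi\mu x)\cos(\pi\lambda y)$. The triangle is $K^+_{[0,1]}=\{(x,y)\in[0,1]\times[0,1] : x\ge y\}$. For $k\in\{0,\dots,M\}$, $d_{k,M}=\tfrac12$ if $k=0$ or $k=M$, and $d_{k,M}=1$ otherwise. $G_{kl}=2$ if $k=l$ and $G_{kl}=1$ otherwise. *)

theory Defs
  imports Complex_Main
begin

definition cos_plus :: "real \<times> real \<Rightarrow> real \<times> real \<Rightarrow> real" where
  "cos_plus = (\<lambda>(lam, mu) (x, y).
     cos (pi * lam * x) * cos (pi * mu * y) + cos (pi * mu * x) * cos (pi * lam * y))"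

definition triangle :: "(real \<times> real) set" where
  "triangle = {(x, y). 0 \<le> x \<and> x \<le> 1 \<and> 0 \<le> y \<and> y \<le> 1 \<and> x \<ge> y}"

definition dwt :: "nat \<Rightarrow> nat \<Rightarrow> real" where
  "dwt k M = (if k = 0 \<or> k = M then 1 / 2 else 1)"

definition Gwt :: "nat \<Rightarrow> nat \<Rightarrow> real" where
  "Gwt k l = (if k = l then 2 else 1)"

definition idx :: "nat \<Rightarrow> (nat \<times> nat) set" where
  "idx N = {(k, l). k \<in> {0..N} \<and> l \<in> {0..N} \<and> k \<ge> l}"

text \<open>Grid coordinates: \<open>node\<close> for types I and III, \<open>midnode\<close> for types II and IV.\<close>

definition node :: "nat \<Rightarrow> nat \<Rightarrow> real" where
  "node M m = real m / real M"

definition midnode :: "nat \<Rightarrow> nat \<Rightarrow> real" where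
  "midnode M m = (real m + 1 / 2) / real M"

text \<open>A function on \<open>triangle\<close> is rendered as a total function \<open>f\<close> on the plane. Only its values
  at grid points are used below, and these all lie in \<open>triangle\<close>, so the values outside it are
  irrelevant.\<close>

lemma node_in_triangle:
  assumes "M > 0" and "(m, n) \<in> idx M"
  shows "(node M m, node M n) \<in> triangle"
  using assms by (auto simp: idx_def triangle_def node_def divide_simps)

lemma midnode_in_triangle:
  assumes "M > 0" and "(m, n) \<in> idx (M - 1)"
  shows "(midnode M m, midnode M n) \<in> triangle"
proof -
  have "real m + 1 \<le> real M" "real n \<le> real m"
    using assms by (auto simp: idx_def)
  then show ?thesis
    using assms(1) by (auto simp: triangle_def midnode_def divide_simps)
qed

definition cI :: "nat \<Rightarrow> (real \<times> real \<Rightarrow> complex) \<Rightarrow> nat \<Rightarrow> nat \<Rightarrow> complex" where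
  "cI M f k l = of_real (4 * dwt k M * dwt l M / (real M ^ 2 * Gwt k l)) *
     (\<Sum>(m, n)\<in>idx M. of_real (inverse (Gwt m n) * dwt m M * dwt n M) * f (node M m, node M n) *
        of_real (cos_plus (real k, real l) (node M m, node M n)))"

definition psiI :: "nat \<Rightarrow> (real \<times> real \<Rightarrow> complex) \<Rightarrow> real \<times> real \<Rightarrow> complex" where
  "psiI M f p = (\<Sum>(k, l)\<in>idx M. cI M f k l * of_real (cos_plus (real k, real l) p))"

definition cII :: "nat \<Rightarrow> (real \<times> real \<Rightarrow> complex) \<Rightarrow> nat \<Rightarrow> nat \<Rightarrow> complex" where
  "cII M f k l = of_real (4 * dwt k M * dwt l M / (real M ^ 2 * Gwt k l)) *
     (\<Sum>(m, n)\<in>idx (M - 1). of_real (inverse (Gwt m n)) * f (midnode M m, midnode M n) *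
        of_real (cos_plus (real k, real l) (midnode M m, midnode M n)))"

definition psiII :: "nat \<Rightarrow> (real \<times> real \<Rightarrow> complex) \<Rightarrow> real \<times> real \<Rightarrow> complex" where
  "psiII M f p = (\<Sum>(k, l)\<in>idx (M - 1). cII M f k l * of_real (cos_plus (real k, real l) p))"

definition cIII :: "nat \<Rightarrow> (real \<times> real \<Rightarrow> complex) \<Rightarrow> nat \<Rightarrow> nat \<Rightarrow> complex" where
  "cIII M f k l = of_real (4 / (real M ^ 2 * Gwt k l)) *
     (\<Sum>(m, n)\<in>idx (M - 1). of_real (dwt m M * dwt n M * inverse (Gwt m n)) * f (node M m, node M n) *
        of_real (cos_plus (real k + 1 / 2, real l + 1 / 2) (node M m, node M n)))"

definition psiIII :: "nat \<Rightarrow> (real \<times> real \<Rightarrow> complex) \<Rightarrow> real \<times> real \<Rightarrow> complex" where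
  "psiIII M f p =
     (\<Sum>(k, l)\<in>idx (M - 1). cIII M f k l * of_real (cos_plus (real k + 1 / 2, real l + 1 / 2) p))"

definition cIV :: "nat \<Rightarrow> (real \<times> real \<Rightarrow> complex) \<Rightarrow> nat \<Rightarrow> nat \<Rightarrow> complex" where
  "cIV M f k l = of_real (4 / (real M ^ 2 * Gwt k l)) *
     (\<Sum>(m, n)\<in>idx (M - 1). of_real (inverse (Gwt m n)) * f (midnode M m, midnode M n) *
        of_real (cos_plus (real k + 1 / 2, real l + 1 / 2) (midnode M m, midnode M n)))"

definition psiIV :: "nat \<Rightarrow> (real \<times> real \<Rightarrow> complex) \<Rightarrow> real \<times> real \<Rightarrow> complex" where
  "psiIV M f p =
     (\<Sum>(k, l)\<in>idx (M - 1). cIV M f k l * of_real (cos_plus (real k + 1 / 2, real l + 1 / 2) p))"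

end

theory Submission
  imports Defs
begin

text \<open>
  In one variable, each of the four discrete cosine transforms is inverted by a discrete
  orthogonality relation \<open>B m * (\<Sum>k. A k * u k m * u k a) = \<delta>\<^sub>m\<^sub>a\<close>, which the product formula for
  cosines reduces to two Dirichlet-type sums. In two variables, a function of \<open>(k, l)\<close> symmetric
  under exchange has half its sum over the full square as its sum over \<open>k \<ge> l\<close> weighted by
  \<open>1 / Gwt k l\<close>, so the kernel factorises into
  \<open>\<delta>\<^sub>m\<^sub>a \<delta>\<^sub>n\<^sub>b + \<delta>\<^sub>m\<^sub>b \<delta>\<^sub>n\<^sub>a\<close>, which for \<open>m \<ge> n\<close> and \<open>a \<ge> b\<close> equals \<open>Gwt m n\<close> times the delta at
  \<open>(m, n) = (a, b)\<close>.
\<close>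

section \<open>From one variable to two\<close>

lemma finite_idx: "finite (idx N)"
  by (rule finite_subset[of _ "{0..N} \<times> {0..N}"]) (auto simp: idx_def)

lemma sum_idx_symmetric:
  fixes h :: "nat \<Rightarrow> nat \<Rightarrow> real"
  assumes sym: "\<And>k l. h k l = h l k"
  shows "(\<Sum>(k, l)\<in>idx N. h k l / Gwt k l) = (\<Sum>k=0..N. \<Sum>l=0..N. h k l) / 2"
proof -
  let ?t = "\<lambda>k l. if l \<le> k then h k l / Gwt k l else 0"
  have "(\<Sum>(k, l)\<in>idx N. h k l / Gwt k l) = (\<Sum>(k, l)\<in>{0..N} \<times> {0..N}. ?t k l)"
    by (rule sum.mono_neutral_cong_left) (auto simp: idx_def split: if_splits)
  then have lower: "(\<Sum>(k, l)\<in>idx N. h k l / Gwt k l) = (\<Sum>k=0..N. \<Sum>l=0..N. ?t k l)"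
    by (simp add: sum.cartesian_product)
  \<comment> \<open>Off the diagonal exactly one of the two terms survives; on it each is
    \<open>h k k / 2\<close>, the factor 2 in \<open>Gwt\<close> preventing a double count.\<close>
  have "h k l = ?t k l + ?t l k" for k l
    using sym[of k l] by (auto simp: Gwt_def)
  then have "(\<Sum>k=0..N. \<Sum>l=0..N. h k l) = (\<Sum>k=0..N. \<Sum>l=0..N. ?t k l + ?t l k)"
    by presburger
  also have "\<dots> = (\<Sum>k=0..N. \<Sum>l=0..N. ?t k l) + (\<Sum>k=0..N. \<Sum>l=0..N. ?t l k)"
    by (simp only: sum.distrib)
  also have "(\<Sum>k=0..N. \<Sum>l=0..N. ?t l k) = (\<Sum>k=0..N. \<Sum>l=0..N. ?t k l)"
    by (rule sum.swap)
  finally show ?thesis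
    using lower by simp
qed

text \<open>Expanding the two symmetrised products gives four separable double sums, equal in pairs;
  this cancels the 1/2 from \<open>sum_idx_symmetric\<close>.\<close>

lemma symmetric_kernel:
  fixes A :: "nat \<Rightarrow> real" and u :: "nat \<Rightarrow> nat \<Rightarrow> real" and N :: nat
  defines "K \<equiv> \<lambda>m a. \<Sum>k=0..N. A k * u k m * u k a"
  shows "(\<Sum>(k, l)\<in>idx N. A k * A l / Gwt k l * (u k m * u l n + u l m * u k n) *
             (u k a * u l b + u l a * u k b)) = K m a * K n b + K m b * K n a"
proof -
  let ?h = "\<lambda>k l. A k * A l * (u k m * u l n + u l m * u k n) * (u k a * u l b + u l a * u k b)"
  let ?P = "\<lambda>p q r s. \<Sum>k=0..N. \<Sum>l=0..N. (A k * u k p * u k r) * (A l * u l q * u l s)"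
  have P: "?P p q r s = K p r * K q s" for p q r s
    by (simp add: K_def sum_product)
  have "(\<Sum>(k, l)\<in>idx N. A k * A l / Gwt k l * (u k m * u l n + u l m * u k n) *
             (u k a * u l b + u l a * u k b)) = (\<Sum>(k, l)\<in>idx N. ?h k l / Gwt k l)"
    by (rule sum.cong) auto
  also have "\<dots> = (\<Sum>k=0..N. \<Sum>l=0..N. ?h k l) / 2"
    by (rule sum_idx_symmetric) (simp add: algebra_simps)
  also have "(\<Sum>k=0..N. \<Sum>l=0..N. ?h k l) = ?P m n a b + ?P m n b a + ?P n m a b + ?P n m b a"
    unfolding sum.distrib[symmetric] by (intro sum.cong refl) (simp add: algebra_simps)
  finally show ?thesis
    unfolding P by simp
qed

text \<open>Covers all four transforms at once: \<open>A\<close> holds the frequency weights,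
  \<open>B\<close> the node weights, and \<open>u k m\<close> is mode \<open>k\<close> at node
  \<open>m\<close>.\<close>

lemma symmetric_interpolation:
  fixes A B :: "nat \<Rightarrow> real" and u :: "nat \<Rightarrow> nat \<Rightarrow> real" and g :: "nat \<Rightarrow> nat \<Rightarrow> complex"
  defines "C \<equiv> \<lambda>k l m n. u k m * u l n + u l m * u k n"
  assumes orth: "\<And>m a. m \<le> N \<Longrightarrow> a \<le> N \<Longrightarrow>
      B m * (\<Sum>k=0..N. A k * u k m * u k a) = (if m = a then 1 else 0)"
    and ab: "b \<le> a" "a \<le> N"
  shows "(\<Sum>(k, l)\<in>idx N. of_real (A k * A l / Gwt k l) *
            (\<Sum>(m, n)\<in>idx N. of_real (inverse (Gwt m n) * B m * B n) * g m n * of_real (C k l m n)) *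
            of_real (C k l a b)) = g a b" (is "?lhs = _")
proof -
  let ?K = "\<lambda>m a. \<Sum>k=0..N. A k * u k m * u k a"
  let ?w = "\<lambda>m n. inverse (Gwt m n) * B m * B n"
  have "?lhs = (\<Sum>p\<in>idx N. \<Sum>q\<in>idx N. case p of (k, l) \<Rightarrow> case q of (m, n) \<Rightarrow>
      of_real (A k * A l / Gwt k l) * (of_real (?w m n) * g m n * of_real (C k l m n)) *
      of_real (C k l a b))"
    by (simp add: sum_distrib_left sum_distrib_right case_prod_unfold)
  also have "\<dots> = (\<Sum>q\<in>idx N. \<Sum>p\<in>idx N. case p of (k, l) \<Rightarrow> case q of (m, n) \<Rightarrow>
      of_real (A k * A l / Gwt k l) * (of_real (?w m n) * g m n * of_real (C k l m n)) *
      of_real (C k l a b))"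
    by (rule sum.swap)
  also have "\<dots> = (\<Sum>(m, n)\<in>idx N. g m n * of_real (?w m n *
      (\<Sum>(k, l)\<in>idx N. A k * A l / Gwt k l * C k l m n * C k l a b)))"
    by (simp add: sum_distrib_left case_prod_unfold mult_ac)
  also have "\<dots> = (\<Sum>(m, n)\<in>idx N. g m n * of_real (?w m n * (?K m a * ?K n b + ?K m b * ?K n a)))"
    by (simp only: C_def symmetric_kernel)
  also have "\<dots> = (\<Sum>q\<in>idx N. if q = (a, b) then g a b else 0)"
  proof (rule sum.cong[OF refl], clarify)
    fix m n assume "(m, n) \<in> idx N"
    then have mn: "m \<le> N" "n \<le> N" "n \<le> m"
      by (auto simp: idx_def)
    have "?w m n * (?K m a * ?K n b + ?K m b * ?K n a) = inverse (Gwt m n) *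
        ((B m * ?K m a) * (B n * ?K n b) + (B m * ?K m b) * (B n * ?K n a))"
      by (simp only: algebra_simps)
    \<comment> \<open>The crossed product needs m = b and n = a; with n \<le> m and b \<le> a this
      forces all four indices to agree. Then both products are 1, and \<open>Gwt\<close> divides by
      their sum 2.\<close>
    also have "\<dots> = (if (m, n) = (a, b) then 1 else 0)"
      using mn ab by (auto simp: orth Gwt_def)
    finally show "g m n * of_real (?w m n * (?K m a * ?K n b + ?K m b * ?K n a)) =
        (if (m, n) = (a, b) then g a b else 0)"
      by (simp only:) auto
  qed
  also have "\<dots> = g a b"
    using ab by (simp add: sum.delta'[OF finite_idx] finite_idx) (simp add: idx_def)
  finally show ?thesis .
qed

section \<open>Cosine sums\<close>

text \<open>The factor 2 sin(t/2) turns each summand into a difference of consecutive sines, so the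
  sum telescopes.\<close>

lemma sum_cos_half_odd: "2 * sin (t / 2) * (\<Sum>k<M. cos ((real k + 1 / 2) * t)) = sin (real M * t)"
proof (induction M)
  case (Suc M)
  have "sin (real (Suc M) * t) - sin (real M * t) = 2 * sin (t / 2) * cos ((real M + 1 / 2) * t)"
    by (simp add: sin_diff_sin algebra_simps add_divide_distrib)
  with Suc show ?case
    by (simp add: algebra_simps)
qed simp

text \<open>The half weights at both ends are those of the trapezoidal rule: each inner point is
  shared by two adjacent intervals.\<close>

lemma sum_dwt_conv_trapezoid:
  fixes g :: "nat \<Rightarrow> real"
  assumes "M > 0"
  shows "(\<Sum>k=0..M. dwt k M * g k) = (\<Sum>k<M. (g k + g (Suc k)) / 2)"
proof -
  have inner: "(\<Sum>k\<in>{0<..<M}. dwt k M * g k) = (\<Sum>k\<in>{0<..<M}. g k)"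
    by (rule sum.cong) (auto simp: dwt_def)
  have ends: "{0..M} = insert 0 (insert M {0<..<M})" "{..<M} = insert 0 {0<..<M}"
    "{..<Suc M} - {0} = insert M {0<..<M}"
    using assms by auto
  have "(\<Sum>k<M. g (Suc k)) = (\<Sum>k\<in>{..<Suc M} - {0}. g k)"
    by (rule sum.reindex_bij_witness[of _ "\<lambda>k. k - 1" Suc]) auto
  then show ?thesis
    using assms inner ends by (simp add: sum.distrib flip: sum_divide_distrib)
      (simp add: dwt_def field_simps)
qed

text \<open>The mean of two neighbouring cosines is the cosine at the midpoint times
  cos(t/2).\<close>

lemma sum_dwt_cos:
  assumes "M > 0"
  shows "(\<Sum>k=0..M. dwt k M * cos (real k * t)) =
           cos (t / 2) * (\<Sum>k<M. cos ((real k + 1 / 2) * t))"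
proof -
  have "(cos (real k * t) + cos (real (Suc k) * t)) / 2 = cos (t / 2) * cos ((real k + 1 / 2) * t)"
    for k
    by (simp add: cos_plus_cos cos_minus algebra_simps add_divide_distrib)
  then show ?thesis
    by (simp only: sum_dwt_conv_trapezoid[OF assms] sum_distrib_left)
qed

text \<open>For j \<noteq> 0 the closed form has right-hand side sin(pi j) = 0, while 0 < |t/2| < pi
  keeps the factor sin(t/2) nonzero.\<close>

lemma sum_cos_half_odd_pi:
  fixes j :: int
  assumes "M > 0" "\<bar>j\<bar> < 2 * int M"
  shows "(\<Sum>k<M. cos ((real k + 1 / 2) * (pi * of_int j / real M))) = (if j = 0 then real M else 0)"
proof (cases "j = 0")
  case False
  let ?t = "pi * of_int j / real M"
  have "\<bar>real_of_int j\<bar> < 2 * real M"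
    using assms(2) by linarith
  then have "\<bar>?t / 2\<bar> < pi"
    using assms(1) by (simp add: abs_mult field_simps)
  moreover have "?t / 2 \<noteq> 0"
    using False assms(1) by simp
  ultimately have "sin (?t / 2) \<noteq> 0"
    using sin_eq_0_pi[of "?t / 2"] unfolding abs_less_iff minus_less_iff[of _ pi] by blast
  moreover have "sin (real M * ?t) = 0"
    using assms(1) by (simp add: sin_zero_iff_int2 mult.commute)
  ultimately show ?thesis
    using False sum_cos_half_odd[of ?t M] by simp
qed simp

text \<open>The boundary case |j| = 2M is aliasing: the angle is a full turn, so every cosine is 1
  and the weights add up to M. Type I meets it at m = a = M.\<close>

lemma sum_dwt_cos_pi:
  fixes j :: int
  assumes "M > 0" "\<bar>j\<bar> \<le> 2 * int M"
  shows "(\<Sum>k=0..M. dwt k M * cos (real k * (pi * of_int j / real M))) =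
           (if j = 0 \<or> \<bar>j\<bar> = 2 * int M then real M else 0)"
proof (cases "\<bar>j\<bar> = 2 * int M")
  case True
  then have "j = 2 * int M \<or> j = - (2 * int M)"
    by linarith
  then have "pi * of_int j / real M = 2 * pi \<or> pi * of_int j / real M = - (2 * pi)"
    using assms(1) by auto
  moreover have "cos (real k * (2 * pi)) = 1" for k
    using cos_int_2pin[of "int k"] by (simp add: mult_ac)
  ultimately have "cos (real k * (pi * of_int j / real M)) = 1" for k
    by (metis cos_minus mult_minus_right)
  then have "(\<Sum>k=0..M. dwt k M * cos (real k * (pi * of_int j / real M))) =
      (\<Sum>k=0..M. dwt k M * 1)"
    by simp
  also have "\<dots> = real M"
    unfolding sum_dwt_conv_trapezoid[OF assms(1)] by simp
  finally show ?thesis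
    using True by simp
next
  case False
  then have "\<bar>j\<bar> < 2 * int M"
    using assms(2) by linarith
  then show ?thesis
    unfolding sum_dwt_cos[OF assms(1)] sum_cos_half_odd_pi[OF assms(1) \<open>\<bar>j\<bar> < 2 * int M\<close>]
    by simp
qed

section \<open>Orthogonality relations in one variable\<close>

lemma cos_mult_cos_scaled:
  fixes c x y :: real
  shows "cos (pi * c * x) * cos (pi * c * y) = (cos (c * (pi * (x - y))) + cos (c * (pi * (x + y)))) / 2"
  by (simp add: cos_times_cos algebra_simps)

lemma sum_weighted_cos_mult_cos:
  fixes w c :: "nat \<Rightarrow> real"
  shows "(\<Sum>k\<in>S. w k * cos (pi * c k * x) * cos (pi * c k * y)) =
     ((\<Sum>k\<in>S. w k * cos (c k * (pi * (x - y)))) + (\<Sum>k\<in>S. w k * cos (c k * (pi * (x + y))))) / 2"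
  unfolding mult.assoc[of "w _"] cos_mult_cos_scaled
  by (simp add: sum.distrib algebra_simps add_divide_distrib flip: sum_divide_distrib)

lemma node_arith:
  "pi * (node M m - node M a) = pi * of_int (int m - int a) / real M"
  "pi * (node M m + node M a) = pi * of_int (int m + int a) / real M"
  by (simp_all add: node_def flip: diff_divide_distrib add_divide_distrib)

text \<open>The two half steps cancel in the difference and add up to 1 in the sum.\<close>

lemma midnode_arith:
  "pi * (midnode M m - midnode M a) = pi * of_int (int m - int a) / real M"
  "pi * (midnode M m + midnode M a) = pi * of_int (int m + int a + 1) / real M"
  by (simp_all add: midnode_def flip: diff_divide_distrib add_divide_distrib)

text \<open>The sum frequency m + a contributes only at m = a = 0 and m = a = M; there it doubles
  the result, which the node weight 1/2 undoes.\<close>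

lemma orthogonality_I:
  assumes "M > 0" "m \<le> M" "a \<le> M"
  shows "dwt m M * (\<Sum>k=0..M. 2 * dwt k M / real M * cos (pi * real k * node M m) *
           cos (pi * real k * node M a)) = (if m = a then 1 else 0)"
proof -
  have "(\<Sum>k=0..M. 2 * dwt k M / real M * cos (pi * real k * node M m) * cos (pi * real k * node M a)) =
      2 / real M * (\<Sum>k=0..M. dwt k M * cos (pi * real k * node M m) * cos (pi * real k * node M a))"
    by (simp add: sum_distrib_left mult_ac)
  also have "\<dots> = 2 / real M * (((if m = a then real M else 0) +
      (if m + a = 0 \<or> m + a = 2 * M then real M else 0)) / 2)"
  proof -
    have conds: "int m - int a = 0 \<or> \<bar>int m - int a\<bar> = 2 * int M \<longleftrightarrow> m = a"
      "int m + int a = 0 \<or> \<bar>int m + int a\<bar> = 2 * int M \<longleftrightarrow> m + a = 0 \<or> m + a = 2 * M"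
      using assms by auto
    have bounds: "\<bar>int m - int a\<bar> \<le> 2 * int M" "\<bar>int m + int a\<bar> \<le> 2 * int M"
      using assms by auto
    show ?thesis
      unfolding sum_weighted_cos_mult_cos node_arith bounds[THEN sum_dwt_cos_pi[OF assms(1)]] conds ..
  qed
  finally show ?thesis
    using assms by (auto simp: dwt_def)
qed

lemma orthogonality_II:
  assumes "M > 0" "m \<le> M - 1" "a \<le> M - 1"
  shows "(\<Sum>k=0..M - 1. 2 * dwt k M / real M * cos (pi * real k * midnode M m) *
           cos (pi * real k * midnode M a)) = (if m = a then 1 else 0)"
proof -
  \<comment> \<open>The mode \<open>k = M\<close> vanishes at midpoints, so the sum may be extended to the trapezoidal one.\<close>
  have "cos (pi * real M * midnode M m) = cos (pi * (real m + 1 / 2))"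
    using assms(1) by (simp add: midnode_def)
  also have "\<dots> = 0"
    by (simp add: distrib_left cos_add mult.commute[of pi])
  finally have last: "cos (pi * real M * midnode M m) = 0" .
  have "{0..M} = insert M {0..M - 1}"
    using assms(1) by auto
  then have "(\<Sum>k=0..M - 1. 2 * dwt k M / real M * cos (pi * real k * midnode M m) *
        cos (pi * real k * midnode M a)) =
      (\<Sum>k=0..M. 2 * dwt k M / real M * cos (pi * real k * midnode M m) *
        cos (pi * real k * midnode M a))"
    using assms(1) by (simp add: last)
  also have "\<dots> = 2 / real M *
      (\<Sum>k=0..M. dwt k M * cos (pi * real k * midnode M m) * cos (pi * real k * midnode M a))"
    by (simp add: sum_distrib_left mult_ac)
  \<comment> \<open>Since 0 < m + a + 1 < 2M, the sum frequency never contributes;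
    \<open>if False\<close> only keeps the shape of \<open>sum_dwt_cos_pi\<close>.\<close>
  also have "\<dots> = 2 / real M * (((if m = a then real M else 0) + (if False then real M else 0)) / 2)"
  proof -
    have conds: "int m - int a = 0 \<or> \<bar>int m - int a\<bar> = 2 * int M \<longleftrightarrow> m = a"
      "int m + int a + 1 = 0 \<or> \<bar>int m + int a + 1\<bar> = 2 * int M \<longleftrightarrow> False"
      using assms by auto
    have bounds: "\<bar>int m - int a\<bar> \<le> 2 * int M" "\<bar>int m + int a + 1\<bar> \<le> 2 * int M"
      using assms by auto
    show ?thesis
      unfolding sum_weighted_cos_mult_cos midnode_arith bounds[THEN sum_dwt_cos_pi[OF assms(1)]] conds ..
  qed
  finally show ?thesis
    using assms(1) by simp
qed

lemma sum_half_odd_cos_mult_cos: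
  assumes "M > 0"
  shows "(\<Sum>k=0..M - 1. 2 / real M * cos (pi * (real k + 1 / 2) * x) * cos (pi * (real k + 1 / 2) * y)) =
     1 / real M * ((\<Sum>k<M. cos ((real k + 1 / 2) * (pi * (x - y)))) +
                   (\<Sum>k<M. cos ((real k + 1 / 2) * (pi * (x + y)))))"
proof -
  have "{0..M - 1} = {..<M}"
    using assms by auto
  then show ?thesis
    unfolding sum_weighted_cos_mult_cos by (simp only: flip: sum_distrib_left) (simp add: add_divide_distrib)
qed

text \<open>Now m + a < 2M, so the sum frequency contributes only at m = a = 0, where
  \<open>dwt 0 M\<close> compensates.\<close>

lemma orthogonality_III:
  assumes "M > 0" "m \<le> M - 1" "a \<le> M - 1"
  shows "dwt m M * (\<Sum>k=0..M - 1. 2 / real M * cos (pi * (real k + 1 / 2) * node M m) *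
           cos (pi * (real k + 1 / 2) * node M a)) = (if m = a then 1 else 0)"
proof -
  have bounds: "\<bar>int m - int a\<bar> < 2 * int M" "\<bar>int m + int a\<bar> < 2 * int M"
    using assms by auto
  show ?thesis
    unfolding sum_half_odd_cos_mult_cos[OF assms(1)] node_arith
      bounds[THEN sum_cos_half_odd_pi[OF assms(1)]]
    using assms by (auto simp: dwt_def)
qed

lemma orthogonality_IV:
  assumes "M > 0" "m \<le> M - 1" "a \<le> M - 1"
  shows "(\<Sum>k=0..M - 1. 2 / real M * cos (pi * (real k + 1 / 2) * midnode M m) *
           cos (pi * (real k + 1 / 2) * midnode M a)) = (if m = a then 1 else 0)"
proof -
  have bounds: "\<bar>int m - int a\<bar> < 2 * int M" "\<bar>int m + int a + 1\<bar> < 2 * int M"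
    using assms by auto
  show ?thesis
    unfolding sum_half_odd_cos_mult_cos[OF assms(1)] midnode_arith
      bounds[THEN sum_cos_half_odd_pi[OF assms(1)]]
    using assms by auto
qed

section \<open>The four interpolation formulas\<close>

lemma psiI_interpolates:
  assumes "M > 0" "n \<le> m" "m \<le> M"
  shows "psiI M f (node M m, node M n) = f (node M m, node M n)"
proof -
  \<comment> \<open>Fixing \<open>A\<close>, \<open>B\<close> and \<open>u\<close> by equations
    keeps the relation in the shape of the premise of \<open>symmetric_interpolation\<close>; the
    \<open>refl\<close>s then instantiate them. Two factors 2/M yield the constant 4/M^2.\<close>
  have "B m' * (\<Sum>k=0..M. A k * u k m' * u k a) = (if m' = a then 1 else 0)"
    if "m' \<le> M" "a \<le> M" "B = (\<lambda>m. dwt m M)" "A = (\<lambda>k. 2 * dwt k M / real M)"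
      "u = (\<lambda>k m. cos (pi * real k * node M m))" for A B u m' a
    using orthogonality_I[OF assms(1)] that by simp
  note interp = symmetric_interpolation[OF this[OF _ _ refl refl refl] assms(2,3),
      where g = "\<lambda>m n. f (node M m, node M n)"]
  show ?thesis
    by (rule trans[OF _ interp]) (simp add: psiI_def cI_def cos_plus_def power2_eq_square mult_ac)
qed

lemma psiII_interpolates:
  assumes "M > 0" "n \<le> m" "m \<le> M - 1"
  shows "psiII M f (midnode M m, midnode M n) = f (midnode M m, midnode M n)"
proof -
  \<comment> \<open>At midpoints all nodes weigh the same, so \<open>B\<close> is constantly 1 and
    \<open>dwt\<close> enters through the frequencies alone.\<close>
  have "B m' * (\<Sum>k=0..M - 1. A k * u k m' * u k a) = (if m' = a then 1 else 0)"
    if "m' \<le> M - 1" "a \<le> M - 1" "B = (\<lambda>m. 1)" "A = (\<lambda>k. 2 * dwt k M / real M)"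
      "u = (\<lambda>k m. cos (pi * real k * midnode M m))" for A B u m' a
    using orthogonality_II[OF assms(1)] that by simp
  note interp = symmetric_interpolation[OF this[OF _ _ refl refl refl] assms(2,3),
      where g = "\<lambda>m n. f (midnode M m, midnode M n)"]
  show ?thesis
    by (rule trans[OF _ interp]) (simp add: psiII_def cII_def cos_plus_def power2_eq_square mult_ac)
qed

lemma psiIII_interpolates:
  assumes "M > 0" "n \<le> m" "m \<le> M - 1"
  shows "psiIII M f (node M m, node M n) = f (node M m, node M n)"
proof -
  \<comment> \<open>Dual to type II: half-odd frequencies carry equal weight, and \<open>dwt\<close>
    moves to the nodes.\<close>
  have "B m' * (\<Sum>k=0..M - 1. A k * u k m' * u k a) = (if m' = a then 1 else 0)"
    if "m' \<le> M - 1" "a \<le> M - 1" "B = (\<lambda>m. dwt m M)" "A = (\<lambda>k. 2 / real M)"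
      "u = (\<lambda>k m. cos (pi * (real k + 1 / 2) * node M m))" for A B u m' a
    using orthogonality_III[OF assms(1)] that by simp
  note interp = symmetric_interpolation[OF this[OF _ _ refl refl refl] assms(2,3),
      where g = "\<lambda>m n. f (node M m, node M n)"]
  show ?thesis
    by (rule trans[OF _ interp]) (simp add: psiIII_def cIII_def cos_plus_def power2_eq_square mult_ac)
qed

lemma psiIV_interpolates:
  assumes "M > 0" "n \<le> m" "m \<le> M - 1"
  shows "psiIV M f (midnode M m, midnode M n) = f (midnode M m, midnode M n)"
proof -
  have "B m' * (\<Sum>k=0..M - 1. A k * u k m' * u k a) = (if m' = a then 1 else 0)"
    if "m' \<le> M - 1" "a \<le> M - 1" "B = (\<lambda>m. 1)" "A = (\<lambda>k. 2 / real M)"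
      "u = (\<lambda>k m. cos (pi * (real k + 1 / 2) * midnode M m))" for A B u m' a
    using orthogonality_IV[OF assms(1)] that by simp
  note interp = symmetric_interpolation[OF this[OF _ _ refl refl refl] assms(2,3),
      where g = "\<lambda>m n. f (midnode M m, midnode M n)"]
  show ?thesis
    by (rule trans[OF _ interp]) (simp add: psiIV_def cIV_def cos_plus_def power2_eq_square mult_ac)
qed

theorem mainTheorem6:
  fixes M :: nat and f :: "real \<times> real \<Rightarrow> complex"
  assumes "M > 0"
  shows "(\<forall>m\<in>{0..M}. \<forall>n\<in>{0..M}. m \<ge> n \<longrightarrow>
            psiI M f (node M m, node M n) = f (node M m, node M n)) \<and>
         (\<forall>m\<in>{0..M - 1}. \<forall>n\<in>{0..M - 1}. m \<ge> n \<longrightarrow>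
            psiII M f (midnode M m, midnode M n) = f (midnode M m, midnode M n)) \<and>
         (\<forall>m\<in>{0..M - 1}. \<forall>n\<in>{0..M - 1}. m \<ge> n \<longrightarrow>
            psiIII M f (node M m, node M n) = f (node M m, node M n)) \<and>
         (\<forall>m\<in>{0..M - 1}. \<forall>n\<in>{0..M - 1}. m \<ge> n \<longrightarrow>
            psiIV M f (midnode M m, midnode M n) = f (midnode M m, midnode M n))"
  using assms psiI_interpolates psiII_interpolates psiIII_interpolates psiIV_interpolates by auto

end
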